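(* Consider the fixed-design linear model $Y=X\beta+W$ described in the context, and let $c=4(3+\sqrt5)$. If $\operatorname{rank}(X_{\mathcal{S}})=s$, then for all subsets $\mathcal{C}\subseteq[d]$ with $\mathcal{C}\neq\mathcal{S}$, $|\mathcal{C}|=s$, satisfying $$\|G_{\mathcal{S},\mathcal{C}}^{1/2}\beta_{\mathcal{S}\setminus\mathcal{C}}\|_2^2\ \ge\ \frac{c\,\sigma^2\cdot|\mathcal{S}\setminus\mathcal{C}|}{n},$$ one has $$\mathbb{P}\{\widehat{\Delta}_{\mathcal{C},\mathcal{S}}\le 0\}\ \le\ 3\exp\left\{-\frac{\|G_{\mathcal{S},\mathcal{C}}^{1/2}\beta_{\mathcal{S}\setminus\mathcal{C}}\|_2^2}{c\,\sigma^2}\cdot n\right\}.$$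
   Context: Model. $Y = X\beta + W$, where $X\in\mathbb{R}^{n\times d}$ is a fixed (deterministic) design matrix, $\beta\in\mathbb{R}^d$ is a fixed coefficient vector, and $W\sim\mathcal{N}(0,\sigma^2 I_n)$ with $\sigma>0$. $\mathbb{P}$ is probability with respect to $W$. Let $[d]=\{1,\dots,d\}$, $\mathcal{S}=\{j\in[d]:\beta_j\neq 0\}$ and $s=|\mathcal{S}|\le\min\{n,d\}$. For $\mathcal{M}\subseteq[d]$, $X_{\mathcal{M}}$ is the submatrix of $X$ consisting of the columns indexed by $\mathcal{M}$, $\beta_{\mathcal{M}}$ is the corresponding subvector of $\beta$, and $\Pi^{\perp}_{\mathcal{M}} = I_n - X_{\mathcal{M}}(X_{\mathcal{M}}^T X_{\mathcal{M}})^{+}X_{\mathcal{M}}^T$ (with $(\cdot)^+$ the Moore–Penrose pseudoinverse) is the orthogonal projector onto the orthogonal complement of the column span of $X_{\mathcal{M}}$. Pairwise statistic: $\widehat{\Delta}_{\mathcal{C},\mathcal{S}}=\|Y-X_{\mathcal{C}}\hat\beta_{\mathcal{C}}\|_2^2-\|Y-X_{\mathcal{S}}\hat\beta_{\mathcal{S}}\|_2^2$, where $\hat\beta_{\mathcal{M}}\in\arg\min_{\beta'_{\mathcal{M}}\in\mathbb{R}^{|\mathcal{M}|}}\|Y-X_{\mathcal{M}}\beta'_{\mathcal{M}}\|_2^2$; equivalently $\widehat{\Delta}_{\mathcal{C},\mathcal{S}}=\|\Pi^{\perp}_{\mathcal{C}}Y\|_2^2-\|\Pi^{\perp}_{\mathcal{S}}Y\|_2^2$.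 $G_{\mathcal{S},\mathcal{C}}=\frac1n X_{\mathcal{S}\setminus\mathcal{C}}^T\,\Pi^{\perp}_{\mathcal{C}}\,X_{\mathcal{S}\setminus\mathcal{C}}$, a symmetric positive semidefinite matrix, and $G_{\mathcal{S},\mathcal{C}}^{1/2}$ is its symmetric positive semidefinite square root, so that $\|G_{\mathcal{S},\mathcal{C}}^{1/2}\beta_{\mathcal{S}\setminus\mathcal{C}}\|_2^2=\frac1n\|\Pi^{\perp}_{\mathcal{C}}X_{\mathcal{S}\setminus\mathcal{C}}\beta_{\mathcal{S}\setminus\mathcal{C}}\|_2^2$. *)

theory Defs
  imports "HOL-Probability.Probability"
begin

text \<open>
  Indices are elements of finite types: \<open>'n\<close> for the \<open>n\<close> observations and \<open>'d\<close> for the \<open>d\<close>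
  covariates, so a set \<open>M :: 'd set\<close> is an arbitrary subset of \<open>[d]\<close>. The space
  \<open>\<real>\<^bsup>|M|\<^esup>\<close> is identified with the coordinate subspace of the vectors in \<open>real^'d\<close> that vanish
  outside \<open>M\<close>. Subvectors and column submatrices are accordingly padded with zeros outside \<open>M\<close>;
  this commutes with products, transposition, rank, pseudoinverse and positive semidefinite
  square root.
\<close>

definition coord_space :: "'d set \<Rightarrow> (real^'d) set" where
  "coord_space M = {b. \<forall>j. j \<notin> M \<longrightarrow> b $ j = 0}"

definition subvec :: "real^'d \<Rightarrow> 'd set \<Rightarrow> real^'d" where
  "subvec b M = (\<chi> j. if j \<in> M then b $ j else 0)"

definition subcols :: "real^'d^'n \<Rightarrow> 'd set \<Rightarrow> real^'d^'n" where
  "subcols X M = (\<chi> i j. if j \<in> M then X $ i $ j else 0)"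

definition vec_support :: "real^'d \<Rightarrow> 'd set" where
  "vec_support b = {j. b $ j \<noteq> 0}"

text \<open>The four Penrose equations; they have exactly one solution \<open>B\<close> for every \<open>A\<close>.\<close>

definition is_pseudoinverse :: "real^'m^'n \<Rightarrow> real^'n^'m \<Rightarrow> bool" where
  "is_pseudoinverse A B \<longleftrightarrow>
     A ** B ** A = A \<and> B ** A ** B = B \<and>
     transpose (A ** B) = A ** B \<and> transpose (B ** A) = B ** A"

definition pseudoinverse :: "real^'m^'n \<Rightarrow> real^'n^'m" where
  "pseudoinverse A = (THE B. is_pseudoinverse A B)"

definition psd_matrix :: "real^'n^'n \<Rightarrow> bool" where
  "psd_matrix A \<longleftrightarrow> transpose A = A \<and> (\<forall>x. 0 \<le> x \<bullet> (A *v x))"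

text \<open>A positive semidefinite matrix has exactly one positive semidefinite square root.\<close>

definition psd_sqrt :: "real^'n^'n \<Rightarrow> real^'n^'n" where
  "psd_sqrt A = (THE R. psd_matrix R \<and> R ** R = A)"

definition proj_perp :: "real^'d^'n \<Rightarrow> 'd set \<Rightarrow> real^'n^'n" where
  "proj_perp X M =
     mat 1 - subcols X M ** pseudoinverse (transpose (subcols X M) ** subcols X M)
               ** transpose (subcols X M)"

definition G_matrix :: "real^'d^'n \<Rightarrow> 'd set \<Rightarrow> 'd set \<Rightarrow> real^'d^'d" where
  "G_matrix X S C =
     (1 / real CARD('n)) *\<^sub>R
       (transpose (subcols X (S - C)) ** proj_perp X C ** subcols X (S - C))"

text \<open>
  A minimizer always exists; it need not be unique, but the residual
  \<open>y - X\<^sub>M \<beta>\<close> is the same for all minimizers \<open>\<beta>\<close>.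
\<close>

definition least_squares :: "real^'d^'n \<Rightarrow> 'd set \<Rightarrow> real^'n \<Rightarrow> real^'d" where
  "least_squares X M y =
     arg_min_on (\<lambda>b. (norm (y - subcols X M *v b))\<^sup>2) (coord_space M)"

definition Delta_hat :: "real^'d^'n \<Rightarrow> 'd set \<Rightarrow> 'd set \<Rightarrow> real^'n \<Rightarrow> real" where
  "Delta_hat X C S y =
     (norm (y - subcols X C *v least_squares X C y))\<^sup>2
     - (norm (y - subcols X S *v least_squares X S y))\<^sup>2"

text \<open>Lebesgue density of the normal distribution on \<open>real^'n\<close> with mean 0 and covariance
  \<open>\<sigma>\<^sup>2 I\<close>.\<close>

definition isotropic_normal_density :: "real \<Rightarrow> real^'n \<Rightarrow> real" where
  "isotropic_normal_density \<sigma> w =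
     exp (- (norm w)\<^sup>2 / (2 * \<sigma>\<^sup>2)) / sqrt ((2 * pi * \<sigma>\<^sup>2) ^ CARD('n))"

end

theory Submission
  imports Defs
begin

text \<open>
  Write \<open>P\<^sub>M\<close> for \<open>proj_perp X M\<close>, the projection onto the orthogonal complement of the columns in \<open>M\<close>,
  and \<open>v = P\<^sub>C X \<beta>\<close> for the part of the mean that the model \<open>C\<close> cannot explain; \<open>|v|\<^sup>2\<close> is \<open>n\<close> times the
  signal strength (\<open>signal_strength\<close>). Since \<open>P\<^sub>S X \<beta> = 0\<close>,
  \<open>Delta_hat = |v|\<^sup>2 + 2 (v \<bullet> W) + |P\<^sub>C W|\<^sup>2 - |P\<^sub>S W|\<^sup>2\<close>.
  Passing from \<open>S\<close> to the smaller model \<open>S \<inter> C\<close> only increases the last norm, and then the two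
  models are nested: \<open>|P\<^bsub>S \<inter> C\<^esub> W|\<^sup>2 - |P\<^sub>C W|\<^sup>2\<close> is a sum of squares \<open>(W \<bullet> b)\<^sup>2\<close> over an orthonormal family
  \<open>B\<close> of at most \<open>card (C - S)\<close> vectors in the column space of \<open>C\<close>, all orthogonal to \<open>v\<close>
  (\<open>Delta_hat_lower_bound\<close>). Hence the event \<open>Delta_hat \<le> 0\<close> lies in
  \<open>|v|\<^sup>2 + 2 (v \<bullet> W) - (\<Sum>b\<in>B. (W \<bullet> b)\<^sup>2) \<le> 0\<close>, whose noise terms are independent.

  For this event Chernoff's bound with exponent \<open>1 / (4 \<sigma>\<^sup>2)\<close> can be computed exactly
  (\<open>gaussian_quadratic_tail\<close>): in an orthonormal basis extending \<open>B\<close> the Gaussian integral factorizes and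
  gives \<open>sqrt 2 ^ card B * exp (- |v|\<^sup>2 / (8 \<sigma>\<^sup>2))\<close>. The signal condition says
  \<open>card (S - C) \<le> a / c\<close> for \<open>a = |v|\<^sup>2 / \<sigma>\<^sup>2\<close>, so the power of \<open>sqrt 2\<close> costs at most \<open>exp (a / c)\<close>, and
  \<open>c \<ge> 16\<close> makes \<open>a / 8\<close> large enough to pay for it (\<open>exponent_arithmetic\<close>).

  The algebra rests on the spectral theorem for real symmetric matrices: it provides the existence
  and uniqueness of positive semidefinite square roots and the pseudoinverse of a Gram matrix. The
  factorization of the Gaussian integral rests on the invariance of Lebesgue measure under linear
  isometries (\<open>lborel_distr_isometry\<close>).
\<close>

section \<open>Orthonormal bases\<close>

definition orthonormal_basis :: "'a::euclidean_space set \<Rightarrow> bool" where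
  "orthonormal_basis E \<longleftrightarrow> pairwise orthogonal E \<and> (\<forall>e\<in>E. norm e = 1) \<and> span E = UNIV"

lemma orthonormal_finite:
  fixes E :: "'a::euclidean_space set"
  assumes "pairwise orthogonal E" "\<And>e. e \<in> E \<Longrightarrow> norm e = 1"
  shows "finite E"
proof -
  have "0 \<notin> E" using assms(2) by force
  then show ?thesis
    using assms(1) pairwise_orthogonal_independent independent_imp_finite by blast
qed

lemma orthonormal_basis_finite: "orthonormal_basis E \<Longrightarrow> finite E"
  unfolding orthonormal_basis_def using orthonormal_finite by blast

lemma orthonormal_basis_inner:
  "orthonormal_basis E \<Longrightarrow> e \<in> E \<Longrightarrow> f \<in> E \<Longrightarrow> e \<bullet> f = (if e = f then 1 else 0)"
  unfolding orthonormal_basis_def pairwise_def orthogonal_def by (simp add: norm_eq_1)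

lemma orthonormal_basis_card:
  fixes E :: "'a::euclidean_space set"
  assumes "orthonormal_basis E"
  shows "card E = DIM('a)"
proof -
  have "0 \<notin> E" using assms by (force simp: orthonormal_basis_def)
  then have "independent E"
    using assms pairwise_orthogonal_independent by (auto simp: orthonormal_basis_def)
  then show ?thesis
    using assms dim_eq_card_independent[of E] dim_span[of E] by (simp add: orthonormal_basis_def)
qed

lemma orthonormal_expansion_inner:
  fixes E :: "'a::euclidean_space set"
  assumes "pairwise orthogonal E" "\<And>e. e \<in> E \<Longrightarrow> norm e = 1" "x \<in> span E"
  shows "x \<bullet> y = (\<Sum>e\<in>E. (x \<bullet> e) * (y \<bullet> e))"
proof -
  have "x \<bullet> y = (\<Sum>e\<in>E. (x \<bullet> e) *\<^sub>R e) \<bullet> y"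
    using orthonormal_basis_expand[of E x] orthonormal_finite[of E] assms by simp
  also have "\<dots> = (\<Sum>e\<in>E. (x \<bullet> e) * (y \<bullet> e))"
    unfolding inner_sum_left by (simp add: inner_commute)
  finally show ?thesis .
qed

text \<open>
  Adjoin an orthonormal basis of the orthogonal complement of \<open>B\<close>.
\<close>

lemma orthonormal_extends_to_basis:
  fixes B :: "'a::euclidean_space set"
  assumes "pairwise orthogonal B" "\<And>b. b \<in> B \<Longrightarrow> norm b = 1"
  obtains E where "B \<subseteq> E" "orthonormal_basis E"
proof -
  let ?V = "{x. \<forall>b\<in>B. orthogonal b x}"
  have "subspace ?V" by (rule subspace_orthogonal_to_vectors)
  then have "\<exists>B'. B' \<subseteq> ?V \<and> pairwise orthogonal B' \<and> (\<forall>x\<in>B'. norm x = 1) \<and> span B' = ?V"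
    by (rule orthonormal_basis_subspace) blast
  then obtain B' where B': "B' \<subseteq> ?V" "pairwise orthogonal B'" "\<forall>x\<in>B'. norm x = 1" "span B' = ?V"
    by blast
  have "pairwise orthogonal (B \<union> B')"
  proof (rule pairwiseI)
    fix x y assume "x \<in> B \<union> B'" "y \<in> B \<union> B'" "x \<noteq> y"
    then show "orthogonal x y"
      using pairwiseD[OF assms(1), of x y] pairwiseD[OF B'(2), of x y] B'(1) orthogonal_commute[of x y]
      by blast
  qed
  moreover have "span (B \<union> B') = UNIV"
  proof -
    have "x \<in> span (B \<union> B')" for x
    proof -
      have "\<exists>y z. y \<in> span B \<and> (\<forall>w\<in>span B. orthogonal z w) \<and> x = y + z"
        by (rule orthogonal_subspace_decomp_exists[of B x]) blast
      then obtain y z where yz: "y \<in> span B" "\<forall>w\<in>span B. orthogonal z w" "x = y + z"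
        by blast
      have "z \<in> span B'"
        using yz(2) span_base[of _ B] unfolding B'(4) by (simp add: orthogonal_commute)
      then show ?thesis
        unfolding yz(3) using yz(1) span_mono[of B "B \<union> B'"] span_mono[of B' "B \<union> B'"]
        by (metis span_add Un_upper1 Un_upper2 subsetD)
    qed
    then show ?thesis by auto
  qed
  ultimately have "orthonormal_basis (B \<union> B')"
    unfolding orthonormal_basis_def using assms(2) B'(3) by auto
  then show ?thesis using that by blast
qed

section \<open>Spectral theorem for real symmetric matrices\<close>

text \<open>
  The first-order condition at a minimum in the form needed below: were \<open>a\<close> nonzero, a small \<open>s\<close> of
  the opposite sign would let the linear term win.
\<close>

lemma quadratic_nonneg_linear_term_zero:
  fixes a b :: real
  assumes "\<And>s. 0 \<le> 2 * s * a + s\<^sup>2 * b"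
  shows "a = 0"
proof -
  define k where "k = \<bar>b\<bar> + 1"
  have k: "k > 0" "b < k" by (auto simp: k_def)
  have "0 \<le> 2 * (- a / k) * a + (- a / k)\<^sup>2 * b" by (rule assms)
  also have "\<dots> = (a\<^sup>2 / k\<^sup>2) * (b - 2 * k)"
    using k by (simp add: field_simps power2_eq_square)
  finally have "0 \<le> (a\<^sup>2 / k\<^sup>2) * (b - 2 * k)" .
  moreover have "b - 2 * k < 0" using k by simp
  ultimately have "a\<^sup>2 / k\<^sup>2 \<le> 0"
    unfolding zero_le_mult_iff by linarith
  then show ?thesis using k
    by (simp add: divide_le_0_iff)
qed

lemma symmetric_inner:
  fixes A :: "real^'n^'n"
  assumes "transpose A = A"
  shows "x \<bullet> (A *v y) = (A *v x) \<bullet> y"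
  using assms by (metis dot_lmul_matrix transpose_matrix_vector)

text \<open>
  A maximizer \<open>x\<close> of \<open>x \<bullet> A x\<close> on the unit sphere of \<open>V\<close>, with maximum \<open>m\<close>, makes
  \<open>m (u \<bullet> u) - u \<bullet> A u\<close> a nonnegative quadratic form on \<open>V\<close> that vanishes at \<open>x\<close>. Its derivative at \<open>x\<close>
  in the direction of the residual \<open>m x - A x\<close>, which lies in \<open>V\<close> by invariance, therefore vanishes;
  that derivative is twice the squared length of the residual.
\<close>

lemma rayleigh_maximizer_is_eigenvector:
  fixes A :: "real^'n^'n"
  assumes sym: "transpose A = A" and V: "subspace V" and inv: "\<And>x. x \<in> V \<Longrightarrow> A *v x \<in> V"
    and ne: "y \<in> V" "y \<noteq> 0"
  obtains x \<mu> where "x \<in> V" "norm x = 1" "A *v x = \<mu> *\<^sub>R x"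
proof -
  let ?K = "V \<inter> sphere 0 1"
  have "compact ?K"
    using closed_subspace[OF V] by (simp add: closed_Int_compact)
  moreover have "(1 / norm y) *\<^sub>R y \<in> ?K"
    using ne V by (auto simp: subspace_scale)
  moreover have "continuous_on ?K (\<lambda>x. x \<bullet> (A *v x))"
    by (intro continuous_intros linear_continuous_on) (simp add: linear_linear)
  ultimately obtain x where x: "x \<in> ?K" and max: "\<And>z. z \<in> ?K \<Longrightarrow> z \<bullet> (A *v z) \<le> x \<bullet> (A *v x)"
    using continuous_attains_sup[of ?K "\<lambda>x. x \<bullet> (A *v x)"] by blast
  define m where "m = x \<bullet> (A *v x)"
  have xx: "x \<bullet> x = 1" "x \<in> V" using x by (auto simp: norm_eq_1)
  have Q: "0 \<le> m * (u \<bullet> u) - u \<bullet> (A *v u)" if "u \<in> V" for u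
  proof (cases "u = 0")
    case False
    let ?z = "(1 / norm u) *\<^sub>R u"
    have "?z \<in> ?K" using False that V by (auto simp: subspace_scale)
    from max[OF this] have "(u \<bullet> (A *v u)) / (norm u)\<^sup>2 \<le> m"
      by (simp add: m_def matrix_vector_mult_scaleR power2_eq_square)
    then show ?thesis using False
      by (simp add: power2_norm_eq_inner divide_le_eq mult.commute)
  qed simp
  define r where "r = m *\<^sub>R x - A *v x"
  have "r \<in> V" unfolding r_def using V inv xx(2) by (simp add: subspace_diff subspace_scale)
  have "r \<bullet> r = 0"
  proof (rule quadratic_nonneg_linear_term_zero)
    fix s :: real
    let ?u = "x + s *\<^sub>R r"
    have "?u \<in> V" using V \<open>r \<in> V\<close> xx(2) by (simp add: subspace_add subspace_scale)
    from Q[OF this] have "0 \<le> m * (?u \<bullet> ?u) - ?u \<bullet> (A *v ?u)" .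
    also have "\<dots> = 2 * s * (r \<bullet> r) + s\<^sup>2 * (m * (r \<bullet> r) - r \<bullet> (A *v r))"
    proof -
      have 1: "r \<bullet> (A *v x) = (A *v r) \<bullet> x" using symmetric_inner[OF sym] .
      have 2: "r \<bullet> r = m * (r \<bullet> x) - r \<bullet> (A *v x)"
        unfolding r_def by (simp add: inner_diff_right inner_diff_left)
      have "m * (?u \<bullet> ?u) - ?u \<bullet> (A *v ?u) =
          (m * (x \<bullet> x) - m) + 2 * s * (m * (r \<bullet> x) - r \<bullet> (A *v x))
          + s\<^sup>2 * (m * (r \<bullet> r) - r \<bullet> (A *v r))"
        using 1 unfolding m_def
        by (simp add: matrix_vector_right_distrib matrix_vector_mult_scaleR inner_add_left inner_add_right
            algebra_simps power2_eq_square inner_commute)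
      then show ?thesis using 2 xx(1) by simp
    qed
    finally show "0 \<le> 2 * s * (r \<bullet> r) + s\<^sup>2 * (m * (r \<bullet> r) - r \<bullet> (A *v r))" .
  qed
  then have "A *v x = m *\<^sub>R x" by (simp add: r_def)
  then show ?thesis using that x by auto
qed

text \<open>
  A largest orthonormal family of eigenvectors is a basis: otherwise its orthogonal complement is a
  nontrivial invariant subspace, in which the Rayleigh quotient produces one more eigenvector.
\<close>

lemma symmetric_matrix_eigenbasis:
  fixes A :: "real^'n^'n"
  assumes sym: "transpose A = A"
  obtains E l where "orthonormal_basis E" "\<forall>e\<in>E. A *v e = l e *\<^sub>R e"
proof -
  define good where "good E \<longleftrightarrow> pairwise orthogonal E \<and>
      (\<forall>e\<in>E. norm e = 1 \<and> (\<exists>\<mu>. A *v e = \<mu> *\<^sub>R e))" for E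
  have card: "finite E \<and> card E \<le> DIM(real^'n)" if "good E" for E
  proof -
    have "0 \<notin> E" using that by (force simp: good_def)
    then have "independent E" using that pairwise_orthogonal_independent by (auto simp: good_def)
    then show ?thesis using independent_bound by blast
  qed
  have "good {}" by (simp add: good_def)
  then have "\<exists>E. good E \<and> (\<forall>F. good F \<longrightarrow> card F \<le> card E)"
  proof (rule ex_has_greatest_nat[where b = "Suc DIM(real^'n)"])
    show "\<forall>F. good F \<longrightarrow> card F < Suc DIM(real^'n)"
      using card by (simp only: less_Suc_eq_le) blast
  qed
  then obtain E where E: "good E" "\<And>F. good F \<Longrightarrow> card F \<le> card E"
    by blast
  let ?V = "{x. \<forall>e\<in>E. orthogonal e x}"
  have sub: "subspace ?V" by (rule subspace_orthogonal_to_vectors)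
  have inv: "A *v x \<in> ?V" if "x \<in> ?V" for x
  proof -
    have "orthogonal e (A *v x)" if "e \<in> E" for e
    proof -
      have "\<exists>\<mu>. A *v e = \<mu> *\<^sub>R e" using that E(1) by (simp add: good_def)
      then obtain \<mu> where "A *v e = \<mu> *\<^sub>R e" by blast
      then have "e \<bullet> (A *v x) = \<mu> * (e \<bullet> x)" by (simp add: symmetric_inner[OF sym])
      then show ?thesis using that \<open>x \<in> ?V\<close> by (auto simp: orthogonal_def)
    qed
    then show ?thesis by simp
  qed
  have triv: "y = 0" if y: "y \<in> ?V" for y
  proof (rule ccontr)
    assume "y \<noteq> 0"
    obtain x \<mu> where x: "x \<in> ?V" "norm x = 1" "A *v x = \<mu> *\<^sub>R x"
      by (rule rayleigh_maximizer_is_eigenvector[OF sym sub inv y \<open>y \<noteq> 0\<close>])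
    have "x \<notin> E" using x(1,2) by (auto simp: orthogonal_def)
    have "pairwise orthogonal (insert x E)"
      using E(1) x(1) by (simp add: good_def pairwise_insert orthogonal_commute)
    then have "good (insert x E)"
      using E(1) x(2,3) unfolding good_def by blast
    then have "card (insert x E) \<le> card E" using E(2) by blast
    then show False using \<open>x \<notin> E\<close> card[OF E(1)] by simp
  qed
  have "pairwise orthogonal E" "\<And>e. e \<in> E \<Longrightarrow> norm e = 1"
    using E(1) by (simp_all add: good_def)
  then obtain F where F: "E \<subseteq> F" "orthonormal_basis F"
    using orthonormal_extends_to_basis by metis
  have "f \<in> E" if "f \<in> F" for f
  proof (rule ccontr)
    assume "f \<notin> E"
    have "e \<bullet> f = 0" if "e \<in> E" for e
      using orthonormal_basis_inner[OF F(2), of e f] F(1) that \<open>f \<in> F\<close> \<open>f \<notin> E\<close> by auto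
    then have "f = 0" by (intro triv) (simp add: orthogonal_def)
    then show False using orthonormal_basis_inner[OF F(2), of f f] \<open>f \<in> F\<close> by simp
  qed
  then have "F = E" using F(1) by blast
  then have "orthonormal_basis E" using F(2) by simp
  moreover have "\<forall>e\<in>E. \<exists>\<mu>. A *v e = \<mu> *\<^sub>R e"
    using E(1) by (simp add: good_def)
  then obtain l where "\<forall>e\<in>E. A *v e = l e *\<^sub>R e"
    by (rule bchoice[THEN exE])
  ultimately show ?thesis by (rule that)
qed

text \<open>
  The matrix \<open>\<Sum>\<^sub>e l\<^sub>e e e\<^sup>T\<close>. A symmetric matrix can be written in this way, and functions of it
  (square root, pseudoinverse) are obtained by applying the function to \<open>l\<close>.
\<close>

definition spectral_matrix :: "(real^'n) set \<Rightarrow> (real^'n \<Rightarrow> real) \<Rightarrow> real^'n^'n" where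
  "spectral_matrix E l = matrix (\<lambda>x. \<Sum>e\<in>E. (l e * (x \<bullet> e)) *\<^sub>R e)"

lemma spectral_matrix_vector:
  "spectral_matrix E l *v x = (\<Sum>e\<in>E. (l e * (x \<bullet> e)) *\<^sub>R e)"
proof -
  have "linear (\<lambda>x. \<Sum>e\<in>E. (l e * (x \<bullet> e)) *\<^sub>R e)"
    by (intro linear_compose_sum ballI linearI)
       (auto simp: inner_add_left algebra_simps)
  then show ?thesis unfolding spectral_matrix_def by (simp add: matrix_works)
qed

lemma spectral_matrix_eigenvector:
  assumes "orthonormal_basis E" "e \<in> E"
  shows "spectral_matrix E l *v e = l e *\<^sub>R e"
proof -
  have "spectral_matrix E l *v e = (\<Sum>f\<in>E. if f = e then l e *\<^sub>R e else 0)"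
    unfolding spectral_matrix_vector
    by (intro sum.cong) (auto simp: orthonormal_basis_inner[OF assms(1)] assms(2))
  then show ?thesis using assms orthonormal_basis_finite[OF assms(1)] by (simp add: sum.delta)
qed

lemma matrix_eq_on_orthonormal_basis:
  fixes A B :: "real^'n^'m"
  assumes "orthonormal_basis E" "\<And>e. e \<in> E \<Longrightarrow> A *v e = B *v e"
  shows "A = B"
proof -
  have "A *v x = B *v x" for x
    using linear_eq_on[of "(*v) A" "(*v) B" x E] assms
    by (auto simp: orthonormal_basis_def)
  then show ?thesis by (simp add: matrix_eq)
qed

lemma spectral_matrix_mult:
  assumes "orthonormal_basis E"
  shows "spectral_matrix E l ** spectral_matrix E m = spectral_matrix E (\<lambda>e. l e * m e)"
  by (rule matrix_eq_on_orthonormal_basis[OF assms])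
     (simp add: spectral_matrix_eigenvector[OF assms] matrix_vector_mul_assoc[symmetric]
        matrix_vector_mult_scaleR mult.commute)

lemma transpose_eqI:
  fixes A :: "real^'n^'n"
  assumes "\<And>x y. x \<bullet> (A *v y) = (A *v x) \<bullet> y"
  shows "transpose A = A"
proof -
  have "transpose A *v x = A *v x" for x
    by (rule vector_eq_rdot[THEN iffD1]) (simp add: assms dot_lmul_matrix)
  then show ?thesis unfolding matrix_eq by blast
qed

lemma spectral_matrix_symmetric: "transpose (spectral_matrix E l) = spectral_matrix E l"
  by (rule transpose_eqI)
     (simp add: spectral_matrix_vector inner_sum_left inner_sum_right inner_commute mult_ac)

lemma spectral_matrix_psd:
  assumes "\<And>e. e \<in> E \<Longrightarrow> 0 \<le> l e"
  shows "psd_matrix (spectral_matrix E l)"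
  unfolding psd_matrix_def
proof (intro conjI allI)
  fix x
  show "0 \<le> x \<bullet> (spectral_matrix E l *v x)"
    unfolding spectral_matrix_vector inner_sum_right
    by (intro sum_nonneg) (simp add: assms mult.assoc)
qed (rule spectral_matrix_symmetric)

lemma spectral_theorem:
  fixes A :: "real^'n^'n"
  assumes "transpose A = A"
  obtains E l where "orthonormal_basis E" "A = spectral_matrix E l"
proof -
  obtain E l where E: "orthonormal_basis E" "\<forall>e\<in>E. A *v e = l e *\<^sub>R e"
    by (rule symmetric_matrix_eigenbasis[OF assms])
  have "A = spectral_matrix E l"
    by (rule matrix_eq_on_orthonormal_basis[OF E(1)]) (simp add: E spectral_matrix_eigenvector)
  then show ?thesis by (rule that[OF E(1)])
qed

section \<open>Square roots and pseudoinverses\<close>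

lemma psd_root_exists:
  fixes A :: "real^'n^'n"
  assumes "psd_matrix A"
  shows "\<exists>R. psd_matrix R \<and> R ** R = A"
proof -
  have "transpose A = A" using assms by (simp add: psd_matrix_def)
  then obtain E l where E: "orthonormal_basis E" "A = spectral_matrix E l"
    by (rule spectral_theorem)
  have l: "0 \<le> l e" if "e \<in> E" for e
  proof -
    have "0 \<le> e \<bullet> (A *v e)" using assms by (simp add: psd_matrix_def)
    also have "\<dots> = l e" using that E
      by (simp add: spectral_matrix_eigenvector orthonormal_basis_inner)
    finally show ?thesis .
  qed
  let ?R = "spectral_matrix E (\<lambda>e. sqrt (l e))"
  have "?R ** ?R = A"
    by (rule matrix_eq_on_orthonormal_basis[OF E(1)])
       (simp add: spectral_matrix_mult E spectral_matrix_eigenvector l)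
  moreover have "psd_matrix ?R" using l by (intro spectral_matrix_psd) simp
  ultimately show ?thesis by blast
qed

text \<open>
  The difference of two roots is symmetric. At an eigenvector \<open>e\<close> of \<open>R - Q\<close> with eigenvalue \<open>\<lambda>\<close>,
  \<open>0 = |R e|\<^sup>2 - |Q e|\<^sup>2 = (R e - Q e) \<bullet> (R e + Q e) = \<lambda> (e \<bullet> R e + e \<bullet> Q e)\<close>. Both inner products are
  nonnegative and their difference is \<open>\<lambda>\<close>, so \<open>\<lambda> = 0\<close> in either case.
\<close>

lemma psd_root_unique:
  fixes R Q :: "real^'n^'n"
  assumes R: "psd_matrix R" and Q: "psd_matrix Q" and eq: "R ** R = Q ** Q"
  shows "R = Q"
proof -
  have symR: "transpose R = R" and symQ: "transpose Q = Q"
    using R Q by (auto simp: psd_matrix_def)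
  have "transpose (R - Q) = R - Q"
    by (rule transpose_eqI)
       (simp add: matrix_vector_mult_diff_rdistrib inner_diff_left inner_diff_right symmetric_inner symR symQ)
  then obtain E l where E: "orthonormal_basis E" "\<forall>e\<in>E. (R - Q) *v e = l e *\<^sub>R e"
    by (rule symmetric_matrix_eigenbasis)
  show ?thesis
  proof (rule matrix_eq_on_orthonormal_basis[OF E(1)])
    fix e assume e: "e \<in> E"
    have d: "R *v e - Q *v e = l e *\<^sub>R e"
      using E(2) e by (simp add: matrix_vector_mult_diff_rdistrib)
    have pos: "0 \<le> e \<bullet> (R *v e)" "0 \<le> e \<bullet> (Q *v e)"
      using R Q by (auto simp: psd_matrix_def)
    have "(R *v e) \<bullet> (R *v e) = (Q *v e) \<bullet> (Q *v e)"
      using eq by (metis matrix_vector_mul_assoc symmetric_inner symR symQ)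
    then have "0 = (R *v e - Q *v e) \<bullet> (R *v e + Q *v e)"
      by (simp add: inner_diff_left inner_add_right inner_commute[of "Q *v e" "R *v e"])
    also have "\<dots> = l e * (e \<bullet> (R *v e) + e \<bullet> (Q *v e))"
      unfolding d by (simp add: inner_add_right distrib_left)
    finally have z: "l e = 0 \<or> e \<bullet> (R *v e) + e \<bullet> (Q *v e) = 0" by simp
    have "e \<bullet> e = 1" using orthonormal_basis_inner[OF E(1) e e] by simp
    then have "l e = e \<bullet> (R *v e) - e \<bullet> (Q *v e)"
      using d by (metis inner_diff_right inner_scaleR_right mult.right_neutral)
    then have "l e = 0" using z pos by linarith
    then show "R *v e = Q *v e" using d by simp
  qed
qed

lemma psd_sqrt:
  assumes "psd_matrix A"
  shows "psd_matrix (psd_sqrt A)" "psd_sqrt A ** psd_sqrt A = A"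
proof -
  have "\<exists>!R. psd_matrix R \<and> R ** R = A"
    using psd_root_exists[OF assms] psd_root_unique by metis
  from theI'[OF this] show "psd_matrix (psd_sqrt A)" "psd_sqrt A ** psd_sqrt A = A"
    unfolding psd_sqrt_def by auto
qed

lemma norm_psd_sqrt_vector:
  assumes "psd_matrix A"
  shows "(norm (psd_sqrt A *v x))\<^sup>2 = x \<bullet> (A *v x)"
proof -
  have "x \<bullet> (A *v x) = x \<bullet> (psd_sqrt A *v (psd_sqrt A *v x))"
    by (simp add: matrix_vector_mul_assoc psd_sqrt(2)[OF assms])
  also have "\<dots> = (psd_sqrt A *v x) \<bullet> (psd_sqrt A *v x)"
    using psd_sqrt(1)[OF assms] by (intro symmetric_inner) (simp add: psd_matrix_def)
  finally show ?thesis by (simp add: power2_norm_eq_inner)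
qed

text \<open>
  The standard argument: the Penrose equations force \<open>A B = A C\<close> and \<open>B A = C A\<close>, because these
  products are symmetric and can therefore be reordered by transposition.
\<close>

lemma pseudoinverse_unique:
  assumes "is_pseudoinverse A B" "is_pseudoinverse A C"
  shows "B = C"
proof -
  have B: "A ** B ** A = A" "B ** A ** B = B" "transpose (A ** B) = A ** B" "transpose (B ** A) = B ** A"
   and C: "A ** C ** A = A" "C ** A ** C = C" "transpose (A ** C) = A ** C" "transpose (C ** A) = C ** A"
    using assms by (auto simp: is_pseudoinverse_def)
  have "A ** B = A ** C ** (A ** B)" using C(1) by (simp add: matrix_mul_assoc)
  also have "\<dots> = transpose (A ** C) ** transpose (A ** B)" by (simp only: B(3) C(3))
  also have "\<dots> = transpose (A ** B ** (A ** C))" by (rule matrix_transpose_mul[symmetric])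
  also have "A ** B ** (A ** C) = A ** C" using B(1) by (simp add: matrix_mul_assoc)
  finally have AB: "A ** B = A ** C" by (simp only: C(3))
  have "C ** A ** (B ** A) = C ** (A ** B ** A)" by (simp add: matrix_mul_assoc)
  then have CA: "C ** A ** (B ** A) = C ** A" by (simp only: B(1))
  have "B ** A = B ** (A ** C ** A)" by (simp only: C(1))
  also have "\<dots> = B ** A ** (C ** A)" by (simp add: matrix_mul_assoc)
  also have "\<dots> = transpose (B ** A) ** transpose (C ** A)" by (simp only: B(4) C(4))
  also have "\<dots> = transpose (C ** A ** (B ** A))" by (rule matrix_transpose_mul[symmetric])
  finally have BA: "B ** A = C ** A" by (simp only: CA C(4))
  have "B = C ** A ** B" using B(2) BA by simp
  also have "\<dots> = C ** (A ** B)" by (simp add: matrix_mul_assoc)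
  also have "\<dots> = C" using C(2) by (simp add: AB matrix_mul_assoc)
  finally show ?thesis .
qed

lemma symmetric_pseudoinverse:
  fixes A :: "real^'n^'n"
  assumes "transpose A = A"
  shows "is_pseudoinverse A (pseudoinverse A)" "transpose (pseudoinverse A) = pseudoinverse A"
proof -
  obtain E l where E: "orthonormal_basis E" "A = spectral_matrix E l"
    by (rule spectral_theorem[OF assms])
  \<comment> \<open>\<open>inverse 0 = 0\<close>, so this inverts exactly the nonzero eigenvalues.\<close>
  let ?B = "spectral_matrix E (\<lambda>e. inverse (l e))"
  have inv: "l e * inverse (l e) * l e = l e" "inverse (l e) * l e * inverse (l e) = inverse (l e)" for e
    by (cases "l e = 0"; simp)+
  have B: "is_pseudoinverse A ?B"
    unfolding is_pseudoinverse_def E(2) spectral_matrix_mult[OF E(1)] inv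
    by (simp add: spectral_matrix_symmetric)
  then have "pseudoinverse A = ?B"
    unfolding pseudoinverse_def using pseudoinverse_unique by blast
  then show "is_pseudoinverse A (pseudoinverse A)" "transpose (pseudoinverse A) = pseudoinverse A"
    using B spectral_matrix_symmetric by auto
qed

section \<open>Projections and least squares\<close>

lemma inner_matrix_vector_transpose:
  fixes A :: "real^'m^'n"
  shows "x \<bullet> (A *v y) = (transpose A *v x) \<bullet> y"
  by (simp add: dot_lmul_matrix)

definition column_space :: "real^'d^'n \<Rightarrow> 'd set \<Rightarrow> (real^'n) set" where
  "column_space X M = span ((\<lambda>j. column j X) ` M)"

lemma column_space_mono: "A \<subseteq> C \<Longrightarrow> column_space X A \<subseteq> column_space X C"
  unfolding column_space_def by (intro span_mono image_mono)

lemma subspace_column_space: "subspace (column_space X M)"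
  unfolding column_space_def by (rule subspace_span)

lemma subcols_mult_vector: "subcols X M *v b = (\<Sum>j\<in>M. (b $ j) *\<^sub>R column j X)"
proof -
  have "subcols X M *v b = (\<Sum>j\<in>UNIV. if j \<in> M then (b $ j) *\<^sub>R column j X else 0)"
    by (simp add: vec_eq_iff matrix_vector_mult_def subcols_def column_def
        if_distrib cong: if_cong)
       (intro allI sum.cong; simp)
  then show ?thesis by (simp add: sum.If_cases)
qed

lemma subcols_mult_subvec: "subcols X M *v subvec b M = subcols X M *v b"
  unfolding subcols_mult_vector by (simp add: subvec_def)

lemma subcols_mult_in_column_space: "subcols X M *v b \<in> column_space X M"
  unfolding subcols_mult_vector column_space_def
  by (intro span_sum span_scale span_base) simp

lemma in_column_spaceE:
  assumes "x \<in> column_space X M"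
  obtains b where "x = subcols X M *v b"
proof -
  have "subspace (range ((*v) (subcols X M)))"
    by (intro linear_subspace_image) auto
  moreover have "(\<lambda>j. column j X) ` M \<subseteq> range ((*v) (subcols X M))"
  proof clarify
    fix j assume "j \<in> M"
    then have "subcols X M *v axis j 1 = column j X"
      unfolding subcols_mult_vector
      by (simp add: axis_def if_distrib[of "\<lambda>c. c *\<^sub>R _"] cong: if_cong)
    then show "column j X \<in> range ((*v) (subcols X M))" by (metis rangeI)
  qed
  ultimately have "column_space X M \<subseteq> range ((*v) (subcols X M))"
    unfolding column_space_def by (rule span_minimal[rotated])
  then show ?thesis using assms that by blast
qed

lemma proj_perp_vector:
  "proj_perp X M *v y = y - subcols X M *v
     (pseudoinverse (transpose (subcols X M) ** subcols X M) *v (transpose (subcols X M) *v y))"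
  unfolding proj_perp_def
  by (simp only: matrix_vector_mult_diff_rdistrib matrix_vector_mul_lid matrix_vector_mul_assoc
      matrix_mul_assoc)

lemma gram_pseudoinverse:
  fixes A :: "real^'m^'n"
  defines "G \<equiv> transpose A ** A"
  shows "G ** pseudoinverse G ** G = G" "transpose (pseudoinverse G) = pseudoinverse G"
proof -
  have "transpose G = G" by (simp add: G_def matrix_transpose_mul)
  from symmetric_pseudoinverse[OF this]
  show "G ** pseudoinverse G ** G = G" "transpose (pseudoinverse G) = pseudoinverse G"
    by (simp_all add: is_pseudoinverse_def)
qed

text \<open>
  Write \<open>G = A\<^sup>T A\<close>. For \<open>x = A b\<close> the projection is \<open>A u\<close> with \<open>u = b - G\<^sup>+ G b\<close>, and
  \<open>|A u|\<^sup>2 = u \<bullet> G u = 0\<close> because \<open>G G\<^sup>+ G = G\<close>.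
\<close>

lemma proj_perp_column_space:
  assumes "x \<in> column_space X M"
  shows "proj_perp X M *v x = 0"
proof -
  define A where "A = subcols X M"
  define G where "G = transpose A ** A"
  define B where "B = pseudoinverse G"
  obtain b where x: "x = A *v b" using in_column_spaceE[OF assms] unfolding A_def by blast
  define u where "u = b - B *v (G *v b)"
  have "proj_perp X M *v x = A *v b - A *v (B *v (transpose A *v (A *v b)))"
    by (simp only: proj_perp_vector x A_def B_def G_def)
  also have "\<dots> = A *v u"
    by (simp only: u_def G_def matrix_vector_mult_diff_distrib matrix_vector_mul_assoc)
  finally have P: "proj_perp X M *v x = A *v u" .
  have "G ** B ** G = G" unfolding B_def G_def by (rule gram_pseudoinverse)
  then have "G *v u = 0"
    by (simp add: u_def matrix_vector_mult_diff_distrib matrix_vector_mul_assoc matrix_mul_assoc)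
  then have "(A *v u) \<bullet> (A *v u) = 0"
    by (simp only: inner_matrix_vector_transpose[of _ A u] G_def matrix_vector_mul_assoc[symmetric]
        inner_zero_left)
  then show ?thesis using P by simp
qed

lemma proj_perp_symmetric: "x \<bullet> (proj_perp X M *v y) = (proj_perp X M *v x) \<bullet> y"
proof -
  define A where "A = subcols X M"
  define B where "B = pseudoinverse (transpose A ** A)"
  have "transpose B = B" unfolding B_def by (rule gram_pseudoinverse)
  have "x \<bullet> (A *v (B *v (transpose A *v y))) = (transpose A *v x) \<bullet> (B *v (transpose A *v y))"
    by (rule inner_matrix_vector_transpose)
  also have "\<dots> = (B *v (transpose A *v x)) \<bullet> (transpose A *v y)"
    by (rule symmetric_inner) fact
  also have "\<dots> = (A *v (B *v (transpose A *v x))) \<bullet> y"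
    using inner_matrix_vector_transpose[of _ "transpose A" y] by (simp only: transpose_transpose)
  finally show ?thesis
    by (simp only: proj_perp_vector A_def B_def inner_diff_left inner_diff_right)
qed

lemma proj_perp_residual: "y - proj_perp X M *v y \<in> column_space X M"
  using subcols_mult_in_column_space[of X M] by (simp only: proj_perp_vector diff_diff_eq2 add_diff_cancel_left')

lemma proj_perp_orthogonal: "x \<in> column_space X M \<Longrightarrow> x \<bullet> (proj_perp X M *v y) = 0"
  by (simp add: proj_perp_symmetric proj_perp_column_space)

lemma proj_perp_fixed:
  assumes "\<And>x. x \<in> column_space X M \<Longrightarrow> x \<bullet> y = 0"
  shows "proj_perp X M *v y = y"
proof -
  let ?r = "y - proj_perp X M *v y"
  have "?r \<bullet> y = 0" using assms proj_perp_residual by blast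
  moreover have "?r \<bullet> (proj_perp X M *v y) = 0" using proj_perp_orthogonal proj_perp_residual by blast
  ultimately have "?r \<bullet> ?r = 0" by (simp add: inner_diff_right)
  then show ?thesis by simp
qed

lemma proj_perp_idem: "proj_perp X M *v (proj_perp X M *v y) = proj_perp X M *v y"
  by (rule proj_perp_fixed) (rule proj_perp_orthogonal)

text \<open>
  Pythagoras: the first summand does not depend on \<open>x\<close>, so the projection gives the least squares
  residual, and enlarging the column set shrinks it.
\<close>

lemma norm_residual:
  assumes "x \<in> column_space X M"
  shows "(norm (y - x))\<^sup>2 = (norm (proj_perp X M *v y))\<^sup>2 + (norm (y - proj_perp X M *v y - x))\<^sup>2"
proof -
  have "y - proj_perp X M *v y - x \<in> column_space X M"
    by (rule subspace_diff[OF subspace_column_space proj_perp_residual assms])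
  then have "orthogonal (proj_perp X M *v y) (y - proj_perp X M *v y - x)"
    by (simp add: orthogonal_def inner_commute[of "proj_perp X M *v y"] proj_perp_orthogonal)
  from norm_add_Pythagorean[OF this] show ?thesis by simp
qed

lemma residual_sum_of_squares:
  "(norm (y - subcols X M *v least_squares X M y))\<^sup>2 = (norm (proj_perp X M *v y))\<^sup>2"
proof -
  let ?f = "\<lambda>b. (norm (y - subcols X M *v b))\<^sup>2"
  obtain b where b: "y - proj_perp X M *v y = subcols X M *v b"
    by (rule in_column_spaceE[OF proj_perp_residual])
  define b0 where "b0 = subvec b M"
  have b0: "b0 \<in> coord_space M" by (simp add: b0_def coord_space_def subvec_def)
  have f: "?f c = (norm (proj_perp X M *v y))\<^sup>2 + (norm (y - proj_perp X M *v y - subcols X M *v c))\<^sup>2"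
    for c by (rule norm_residual[OF subcols_mult_in_column_space])
  have f0: "?f b0 = (norm (proj_perp X M *v y))\<^sup>2"
    unfolding f b b0_def subcols_mult_subvec by simp
  have "is_arg_min ?f (\<lambda>c. c \<in> coord_space M) b0"
    unfolding is_arg_min_linorder using b0 f0 f by (metis le_add_same_cancel1 zero_le_power2)
  then have "is_arg_min ?f (\<lambda>c. c \<in> coord_space M) (least_squares X M y)"
    unfolding least_squares_def arg_min_on_def arg_min_def by (rule someI)
  then have "?f (least_squares X M y) \<le> ?f b0"
    using b0 by (simp add: is_arg_min_linorder)
  moreover have "(norm (proj_perp X M *v y))\<^sup>2 \<le> ?f (least_squares X M y)" unfolding f by simp
  ultimately show ?thesis using f0 by linarith
qed

lemma proj_perp_antimono:
  assumes "A \<subseteq> C"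
  shows "(norm (proj_perp X C *v y))\<^sup>2 \<le> (norm (proj_perp X A *v y))\<^sup>2"
proof -
  have "y - proj_perp X A *v y \<in> column_space X C"
    using column_space_mono[OF assms] proj_perp_residual by blast
  from norm_residual[OF this, of y] show ?thesis by simp
qed

text \<open>
  Turns the signal strength into the length of the part of the mean that the columns of \<open>C\<close> miss.
  The coordinates in \<open>S \<inter> C\<close> may be added back to \<open>\<beta>\<close> because their columns are annihilated.
\<close>

lemma signal_strength:
  fixes X :: "real^'d^'n"
  assumes "S = vec_support \<beta>"
  shows "real CARD('n) * (norm (psd_sqrt (G_matrix X S C) *v subvec \<beta> (S - C)))\<^sup>2
     = (norm (proj_perp X C *v (X *v \<beta>)))\<^sup>2"
proof -
  let ?A = "subcols X (S - C)" and ?P = "proj_perp X C"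
  have G: "x \<bullet> (G_matrix X S C *v y) = (1 / real CARD('n)) * ((?P *v (?A *v x)) \<bullet> (?P *v (?A *v y)))"
    for x y
  proof -
    have "x \<bullet> (G_matrix X S C *v y) = (1 / real CARD('n)) * (x \<bullet> (transpose ?A *v (?P *v (?A *v y))))"
      unfolding G_matrix_def
      by (simp only: scaleR_matrix_vector_assoc[symmetric] matrix_vector_mul_assoc matrix_mul_assoc
          inner_scaleR_right)
    also have "x \<bullet> (transpose ?A *v (?P *v (?A *v y))) = (?A *v x) \<bullet> (?P *v (?A *v y))"
      by (simp only: inner_matrix_vector_transpose transpose_transpose)
    also have "\<dots> = (?A *v x) \<bullet> (?P *v (?P *v (?A *v y)))"
      by (simp only: proj_perp_idem)
    finally show ?thesis by (simp only: proj_perp_symmetric)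
  qed
  have "psd_matrix (G_matrix X S C)"
    unfolding psd_matrix_def
  proof (intro conjI allI transpose_eqI)
    fix x y
    show "0 \<le> x \<bullet> (G_matrix X S C *v x)" unfolding G by simp
    show "x \<bullet> (G_matrix X S C *v y) = (G_matrix X S C *v x) \<bullet> y"
      unfolding inner_commute[of "G_matrix X S C *v x"] G by (simp add: inner_commute)
  qed
  then have "(norm (psd_sqrt (G_matrix X S C) *v subvec \<beta> (S - C)))\<^sup>2
      = (1 / real CARD('n)) * (norm (?P *v (?A *v \<beta>)))\<^sup>2"
    by (simp add: norm_psd_sqrt_vector G subcols_mult_subvec power2_norm_eq_inner[of "?P *v _"])
  moreover have "?P *v (?A *v \<beta>) = ?P *v (X *v \<beta>)"
  proof -
    have "subcols X UNIV = X" by (simp add: subcols_def vec_eq_iff)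
    then have "X *v \<beta> = (\<Sum>j\<in>UNIV. (\<beta> $ j) *\<^sub>R column j X)"
      using subcols_mult_vector[of X UNIV \<beta>] by simp
    also have "\<dots> = (\<Sum>j\<in>S. (\<beta> $ j) *\<^sub>R column j X)"
      by (rule sum.mono_neutral_right) (auto simp: assms vec_support_def)
    also have "\<dots> = (\<Sum>j\<in>S - C. (\<beta> $ j) *\<^sub>R column j X) + (\<Sum>j\<in>S \<inter> C. (\<beta> $ j) *\<^sub>R column j X)"
      using sum.Int_Diff[of S _ C] by (simp add: add.commute)
    also have "\<dots> = ?A *v \<beta> + subcols X (S \<inter> C) *v \<beta>"
      by (simp only: subcols_mult_vector)
    finally have "X *v \<beta> = ?A *v \<beta> + subcols X (S \<inter> C) *v \<beta>" .
    moreover have "?P *v (subcols X (S \<inter> C) *v \<beta>) = 0"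
      using subcols_mult_in_column_space column_space_mono[of "S \<inter> C" C X]
      by (intro proj_perp_column_space) auto
    ultimately show ?thesis by (simp add: matrix_vector_right_distrib)
  qed
  ultimately show ?thesis by simp
qed

text \<open>
  The columns in \<open>C - A\<close>, projected away from those in \<open>A\<close>, span the orthogonal complement of
  \<open>column_space X A\<close> in \<open>column_space X C\<close>; \<open>B\<close> is an orthonormal basis of it. The bound on its size is
  what lets the tail bound depend on the number of wrong columns only, and not on \<open>card C\<close>.
\<close>

lemma proj_perp_increment:
  fixes X :: "real^'d^'n"
  assumes "A \<subseteq> C"
  obtains B where "pairwise orthogonal B" "\<forall>b\<in>B. norm b = 1" "B \<subseteq> column_space X C"
    "card B \<le> card (C - A)"
    "\<forall>w. (norm (proj_perp X A *v w))\<^sup>2 = (norm (proj_perp X C *v w))\<^sup>2 + (\<Sum>b\<in>B. (w \<bullet> b)\<^sup>2)"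
proof -
  let ?P = "\<lambda>w. proj_perp X A *v w" and ?Q = "\<lambda>w. proj_perp X C *v w"
  define K where "K = (\<lambda>j. ?P (column j X)) ` (C - A)"
  have "\<exists>B. B \<subseteq> span K \<and> pairwise orthogonal B \<and> (\<forall>x\<in>B. norm x = 1) \<and> card B = dim (span K)
      \<and> span B = span K"
    by (rule orthonormal_basis_subspace[OF subspace_span[of K]]) blast
  then obtain B where B: "B \<subseteq> span K" "pairwise orthogonal B" "\<forall>x\<in>B. norm x = 1"
      "card B = dim (span K)" "span B = span K" by blast
  have "dim (span K) \<le> card K" by (simp add: dim_le_card' K_def)
  also have "\<dots> \<le> card (C - A)" unfolding K_def by (rule card_image_le) simp
  finally have card: "card B \<le> card (C - A)" using B(4) by simp
  have KC: "?P x \<in> column_space X C" if "x \<in> column_space X C" for x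
  proof -
    have "x - ?P x \<in> column_space X C"
      using proj_perp_residual column_space_mono[OF assms] by blast
    from subspace_diff[OF subspace_column_space that this] show ?thesis by simp
  qed
  have "K \<subseteq> column_space X C"
  proof -
    have "column j X \<in> column_space X C" if "j \<in> C" for j
      using that by (simp add: column_space_def span_base)
    then show ?thesis unfolding K_def using KC by blast
  qed
  then have BC: "B \<subseteq> column_space X C"
    using B(1) span_minimal[OF _ subspace_column_space] by blast
  have PB: "?P b = b" if "b \<in> B" for b
  proof (rule proj_perp_fixed)
    fix x assume x: "x \<in> column_space X A"
    have "K \<subseteq> {y. orthogonal x y}"
      using proj_perp_orthogonal[OF x] by (auto simp: K_def orthogonal_def)
    then have "span K \<subseteq> {y. orthogonal x y}"
      by (intro span_minimal subspace_orthogonal_to_vector)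
    then show "x \<bullet> b = 0" using that B(1) by (auto simp: orthogonal_def)
  qed
  have "(norm (?P w))\<^sup>2 = (norm (?Q w))\<^sup>2 + (\<Sum>b\<in>B. (w \<bullet> b)\<^sup>2)" for w
  proof -
    define r where "r = w - ?Q w"
    have r: "r \<in> column_space X C" unfolding r_def by (rule proj_perp_residual)
    have PQ: "?P (?Q w) = ?Q w"
      using proj_perp_orthogonal column_space_mono[OF assms] by (intro proj_perp_fixed) blast
    have Pw: "?P w = ?Q w + ?P r"
      unfolding r_def by (simp add: matrix_vector_mult_diff_distrib PQ)
    have "?P r \<in> span B"
    proof -
      obtain c where c: "r = subcols X C *v c" by (rule in_column_spaceE[OF r])
      have "?P r = (\<Sum>j\<in>C. (c $ j) *\<^sub>R ?P (column j X))"
        unfolding c subcols_mult_vector by (simp add: vec.sum matrix_vector_mult_scaleR linear_sum)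
      also have "\<dots> \<in> span K"
      proof (intro span_sum span_scale)
        fix j assume "j \<in> C"
        show "?P (column j X) \<in> span K"
        proof (cases "j \<in> A")
          case True
          then have "?P (column j X) = 0"
            by (intro proj_perp_column_space) (simp add: column_space_def span_base)
          then show ?thesis by (simp add: span_zero)
        qed (use \<open>j \<in> C\<close> in \<open>auto simp: K_def intro: span_base\<close>)
      qed
      finally show ?thesis by (simp add: B(5))
    qed
    then have "?P r \<bullet> ?P r = (\<Sum>b\<in>B. (?P r \<bullet> b) * (?P r \<bullet> b))"
      using B(2,3) by (intro orthonormal_expansion_inner) auto
    also have "\<dots> = (\<Sum>b\<in>B. (w \<bullet> b)\<^sup>2)"
    proof (rule sum.cong[OF refl])
      fix b assume b: "b \<in> B"
      have "?P r \<bullet> b = r \<bullet> b"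
        using PB[OF b] proj_perp_symmetric[of r X A b] by simp
      also have "\<dots> = w \<bullet> b"
        using b BC proj_perp_orthogonal[of b X C w]
        by (auto simp: r_def inner_diff_right inner_commute[of _ b])
      finally show "(?P r \<bullet> b) * (?P r \<bullet> b) = (w \<bullet> b)\<^sup>2" by (simp add: power2_eq_square)
    qed
    finally have "(norm (?P r))\<^sup>2 = (\<Sum>b\<in>B. (w \<bullet> b)\<^sup>2)" by (simp add: power2_norm_eq_inner)
    moreover have "orthogonal (?Q w) (?P r)"
      using proj_perp_orthogonal[OF KC[OF r]] by (simp add: orthogonal_def inner_commute)
    ultimately show ?thesis unfolding Pw by (simp add: norm_add_Pythagorean)
  qed
  then show ?thesis by (intro that[OF B(2,3) BC card]) blast
qed

text \<open>
  The mean lies in the span of the columns of \<open>S\<close>, so the residual sum of squares for \<open>S\<close> is that of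
  the noise alone, and it is at most the residual sum of squares of the noise for \<open>S \<inter> C\<close>. Comparing
  the models \<open>S \<inter> C\<close> and \<open>C\<close>, which are nested, leaves a sum of squares along \<open>B\<close>. The vector \<open>v\<close> is
  orthogonal to \<open>B\<close>, which makes the linear and the quadratic noise terms independent.
\<close>

lemma Delta_hat_lower_bound:
  fixes X :: "real^'d^'n"
  assumes S: "S = vec_support \<beta>" and v: "v = proj_perp X C *v (X *v \<beta>)"
  obtains B where "pairwise orthogonal B" "\<forall>b\<in>B. norm b = 1" "\<forall>b\<in>B. b \<bullet> v = 0"
    "card B \<le> card (C - S)"
    "\<forall>w. (norm v)\<^sup>2 + 2 * (v \<bullet> w) - (\<Sum>b\<in>B. (w \<bullet> b)\<^sup>2) \<le> Delta_hat X C S (X *v \<beta> + w)"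
proof -
  obtain B where B: "pairwise orthogonal B" "\<forall>b\<in>B. norm b = 1" "B \<subseteq> column_space X C"
    "card B \<le> card (C - S \<inter> C)"
    "\<forall>w. (norm (proj_perp X (S \<inter> C) *v w))\<^sup>2 = (norm (proj_perp X C *v w))\<^sup>2 + (\<Sum>b\<in>B. (w \<bullet> b)\<^sup>2)"
    by (rule proj_perp_increment[of "S \<inter> C" C X]) auto
  have "C - S \<inter> C = C - S" by blast
  then have card: "card B \<le> card (C - S)" using B(4) by simp
  have Bv: "\<forall>b\<in>B. b \<bullet> v = 0" unfolding v using B(3) proj_perp_orthogonal by blast
  have mean: "X *v \<beta> \<in> column_space X S"
  proof -
    have "X *v \<beta> = subcols X S *v \<beta>"
      by (auto simp: vec_eq_iff matrix_vector_mult_def subcols_def S vec_support_def intro!: sum.cong)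
    then show ?thesis by (simp add: subcols_mult_in_column_space)
  qed
  have "(norm v)\<^sup>2 + 2 * (v \<bullet> w) - (\<Sum>b\<in>B. (w \<bullet> b)\<^sup>2) \<le> Delta_hat X C S (X *v \<beta> + w)" for w
  proof -
    have "v \<bullet> (proj_perp X C *v w) = v \<bullet> w"
      unfolding v by (simp add: proj_perp_symmetric proj_perp_idem)
    then have C: "(norm (proj_perp X C *v (X *v \<beta> + w)))\<^sup>2
        = (norm v)\<^sup>2 + 2 * (v \<bullet> w) + (norm (proj_perp X C *v w))\<^sup>2"
      unfolding matrix_vector_right_distrib v[symmetric] power2_norm_eq_inner
      by (simp add: inner_add_left inner_add_right inner_commute)
    have "proj_perp X S *v (X *v \<beta> + w) = proj_perp X S *v w"
      using proj_perp_column_space[OF mean] by (simp add: matrix_vector_right_distrib)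
    then have "(norm (proj_perp X S *v (X *v \<beta> + w)))\<^sup>2 \<le> (norm (proj_perp X (S \<inter> C) *v w))\<^sup>2"
      using proj_perp_antimono[of "S \<inter> C" S X w] by simp
    then show ?thesis unfolding Delta_hat_def residual_sum_of_squares C using B(5) by simp
  qed
  then show ?thesis by (intro that[OF B(1,2) Bv card]) blast
qed

section \<open>Gaussian integrals in orthonormal coordinates\<close>

text \<open>
  The uniqueness argument for Haar measure. With \<open>k\<close> the indicator of the unit ball, the integral
  of \<open>1\<^sub>A (T z) k (y - T z)\<close> over \<open>y\<close> and \<open>z\<close> is evaluated in both orders. Integrating over \<open>y\<close> first
  gives the image measure of \<open>A\<close> times the volume of the ball. Integrating over \<open>z\<close> first and
  translating \<open>z\<close> by \<open>u\<close>, where \<open>y = T u\<close>, turns the integrand into \<open>1\<^sub>A (y + T z) k z\<close>, since the ball is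
  invariant under \<open>- T\<close>; this integrates to the Lebesgue measure of \<open>A\<close> times the volume of the ball.
\<close>

lemma lborel_distr_isometry:
  fixes T :: "'a::euclidean_space \<Rightarrow> 'a"
  assumes T: "linear T" and iso: "\<And>x. norm (T x) = norm x"
  shows "distr lborel borel T = lborel"
proof (rule measure_eqI)
  have [measurable]: "T \<in> borel_measurable borel"
    by (intro borel_measurable_continuous_onI linear_continuous_on) (simp add: T linear_linear)
  have "inj T"
    using T iso by (metis linear_injective_0 norm_eq_zero)
  then have "surj T"
    using T linear_injective_imp_surjective by blast
  let ?B = "ball (0::'a) 1"
  fix A assume "A \<in> sets (distr lborel borel T)"
  then have [measurable]: "A \<in> sets borel" by simp
  have shift: "(\<integral>\<^sup>+z. f (z + u) \<partial>lborel) = (\<integral>\<^sup>+z. f z \<partial>lborel)"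
    if [measurable]: "f \<in> borel_measurable borel" for f :: "'a \<Rightarrow> ennreal" and u
  proof -
    have "(\<integral>\<^sup>+z. f z \<partial>lborel) = (\<integral>\<^sup>+z. f z \<partial>distr lborel borel ((+) u))"
      by (simp only: lborel_distr_plus)
    also have "\<dots> = (\<integral>\<^sup>+z. f (u + z) \<partial>lborel)" by (rule nn_integral_distr) auto
    finally show ?thesis by (simp add: add.commute)
  qed
  define a :: "'a \<Rightarrow> ennreal" where "a = indicator A"
  define k :: "'a \<Rightarrow> ennreal" where "k = indicator ?B"
  have [measurable]: "a \<in> borel_measurable borel" "k \<in> borel_measurable borel"
    by (simp_all add: a_def k_def borel_measurable_indicator)
  have k_even: "k (- T z) = k z" for z by (simp add: k_def indicator_def iso)
  have int_a: "(\<integral>\<^sup>+z. a z \<partial>lborel) = emeasure lborel A"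
    and int_k: "(\<integral>\<^sup>+z. k z \<partial>lborel) = emeasure lborel ?B"
    by (simp_all add: a_def k_def)
  have int_aT: "(\<integral>\<^sup>+z. a (T z) \<partial>lborel) = emeasure (distr lborel borel T) A"
  proof -
    have "(\<integral>\<^sup>+z. a (T z) \<partial>lborel) = (\<integral>\<^sup>+z. a z \<partial>distr lborel borel T)"
      by (rule nn_integral_distr[symmetric]) measurable
    then show ?thesis by (simp add: a_def)
  qed
  have "emeasure lborel ?B * emeasure (distr lborel borel T) A
      = (\<integral>\<^sup>+z. a (T z) * (\<integral>\<^sup>+y. k y \<partial>lborel) \<partial>lborel)"
    unfolding int_k int_aT[symmetric] by (subst nn_integral_multc) (measurable, rule mult.commute)
  also have "\<dots> = (\<integral>\<^sup>+z. a (T z) * (\<integral>\<^sup>+y. k (y + - T z) \<partial>lborel) \<partial>lborel)"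
    by (simp only: shift[OF \<open>k \<in> borel_measurable borel\<close>])
  also have "\<dots> = (\<integral>\<^sup>+z. (\<integral>\<^sup>+y. a (T z) * k (y + - T z) \<partial>lborel) \<partial>lborel)"
    by (intro nn_integral_cong nn_integral_cmult[symmetric]) measurable
  also have "\<dots> = (\<integral>\<^sup>+y. (\<integral>\<^sup>+z. a (T z) * k (y + - T z) \<partial>lborel) \<partial>lborel)"
    by (rule lborel_pair.Fubini') measurable
  also have "\<dots> = (\<integral>\<^sup>+y. (\<integral>\<^sup>+z. a (y + T z) * k z \<partial>lborel) \<partial>lborel)"
  proof (rule nn_integral_cong)
    fix y :: 'a
    obtain u where u: "y = T u" using \<open>surj T\<close> by blast
    have "(\<integral>\<^sup>+z. a (T z) * k (y + - T z) \<partial>lborel)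
        = (\<integral>\<^sup>+z. a (T (z + u)) * k (y + - T (z + u)) \<partial>lborel)"
      by (rule shift[symmetric]) measurable
    also have "\<dots> = (\<integral>\<^sup>+z. a (y + T z) * k z \<partial>lborel)"
      by (simp add: u linear_add[OF T] k_even add.commute)
    finally show "(\<integral>\<^sup>+z. a (T z) * k (y + - T z) \<partial>lborel) = (\<integral>\<^sup>+z. a (y + T z) * k z \<partial>lborel)" .
  qed
  also have "\<dots> = (\<integral>\<^sup>+z. (\<integral>\<^sup>+y. a (y + T z) * k z \<partial>lborel) \<partial>lborel)"
    by (rule lborel_pair.Fubini') measurable
  also have "\<dots> = (\<integral>\<^sup>+z. (\<integral>\<^sup>+y. a (y + T z) \<partial>lborel) * k z \<partial>lborel)"
    by (intro nn_integral_cong nn_integral_multc) measurable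
  also have "\<dots> = (\<integral>\<^sup>+z. emeasure lborel A * k z \<partial>lborel)"
    by (simp only: shift[OF \<open>a \<in> borel_measurable borel\<close>] int_a)
  also have "\<dots> = emeasure lborel ?B * emeasure lborel A"
    unfolding int_k[symmetric] by (subst nn_integral_cmult) (measurable, rule mult.commute)
  finally have eq: "emeasure lborel ?B * emeasure (distr lborel borel T) A
      = emeasure lborel ?B * emeasure lborel A" .
  have "emeasure lborel ?B \<noteq> top" using emeasure_lborel_ball_finite[of "0::'a" 1] by auto
  moreover have "emeasure lborel ?B \<noteq> 0"
    using content_ball_pos[of 1 "0::'a"] by (auto simp: measure_def)
  ultimately show "emeasure (distr lborel borel T) A = emeasure lborel A"
    using eq by (simp add: ennreal_mult_cancel_left)
qed simp

text \<open>
  Fubini's theorem for product functions, transported from the standard basis by the isometry that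
  maps it to \<open>E\<close>.
\<close>

lemma nn_integral_orthonormal_basis_prod:
  fixes E :: "'a::euclidean_space set" and g :: "'a \<Rightarrow> real \<Rightarrow> ennreal"
  assumes E: "orthonormal_basis E" and [measurable]: "\<And>e. g e \<in> borel_measurable borel"
  shows "(\<integral>\<^sup>+w. (\<Prod>e\<in>E. g e (w \<bullet> e)) \<partial>lborel) = (\<Prod>e\<in>E. \<integral>\<^sup>+x. g e x \<partial>lborel)"
proof -
  obtain h :: "'a \<Rightarrow> 'a" where h: "bij_betw h Basis E"
    using finite_same_card_bij[OF finite_Basis orthonormal_basis_finite[OF E]]
    by (auto simp: orthonormal_basis_card[OF E])
  have hE: "h b \<in> E" if "b \<in> Basis" for b using h that bij_betwE by blast
  have hh: "h b \<bullet> h c = (if b = c then 1 else 0)" if "b \<in> Basis" "c \<in> Basis" for b c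
    using orthonormal_basis_inner[OF E hE[OF that(1)] hE[OF that(2)]] h that
    by (auto simp: bij_betw_def inj_on_def)
  define T where "T x = (\<Sum>b\<in>Basis. (x \<bullet> b) *\<^sub>R h b)" for x
  have Th: "T x \<bullet> h c = x \<bullet> c" if "c \<in> Basis" for x c
  proof -
    have "T x \<bullet> h c = (\<Sum>b\<in>Basis. if b = c then x \<bullet> c else 0)"
      unfolding T_def inner_sum_left by (intro sum.cong) (auto simp: hh that)
    then show ?thesis using that by simp
  qed
  have lin: "linear T"
    unfolding T_def by (intro linearI) (simp_all add: inner_add_left algebra_simps sum.distrib scaleR_sum_right)
  have iso: "norm (T x) = norm x" for x
  proof -
    have "T x \<bullet> T x = (\<Sum>b\<in>Basis. (x \<bullet> b) * (T x \<bullet> h b))"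
      by (subst (2) T_def) (simp add: inner_sum_right)
    also have "\<dots> = x \<bullet> x" by (simp add: Th euclidean_inner[of x x])
    finally show ?thesis by (simp add: norm_eq_sqrt_inner)
  qed
  have [measurable]: "T \<in> borel_measurable borel"
    by (intro borel_measurable_continuous_onI linear_continuous_on) (simp add: lin linear_linear)
  have "(\<integral>\<^sup>+w. (\<Prod>e\<in>E. g e (w \<bullet> e)) \<partial>lborel)
      = (\<integral>\<^sup>+w. (\<Prod>e\<in>E. g e (w \<bullet> e)) \<partial>distr lborel borel T)"
    by (simp only: lborel_distr_isometry[OF lin iso])
  also have "\<dots> = (\<integral>\<^sup>+w. (\<Prod>e\<in>E. g e (T w \<bullet> e)) \<partial>lborel)"
    by (rule nn_integral_distr) measurable
  also have "\<dots> = (\<integral>\<^sup>+w. (\<Prod>b\<in>Basis. g (h b) (w \<bullet> b)) \<partial>lborel)"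
    by (simp add: prod.reindex_bij_betw[OF h, symmetric] Th)
  also have "\<dots> = (\<Prod>b\<in>Basis. \<integral>\<^sup>+x. g (h b) x \<partial>lborel)"
    by (rule nn_integral_lborel_prod) simp_all
  also have "\<dots> = (\<Prod>e\<in>E. \<integral>\<^sup>+x. g e x \<partial>lborel)"
    by (rule prod.reindex_bij_betw[OF h])
  finally show ?thesis .
qed

lemma nn_integral_normal_density:
  assumes "\<sigma> > 0"
  shows "(\<integral>\<^sup>+x. ennreal (normal_density \<mu> \<sigma> x) \<partial>lborel) = 1"
  using assms by (subst nn_integral_eq_integral) (auto simp: normal_density_nonneg)

lemma isotropic_normal_density_orthonormal:
  fixes E :: "(real^'n) set"
  assumes E: "orthonormal_basis E"
  shows "isotropic_normal_density \<sigma> w = (\<Prod>e\<in>E. normal_density 0 \<sigma> (w \<bullet> e))"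
proof -
  have norm: "(norm w)\<^sup>2 = (\<Sum>e\<in>E. (w \<bullet> e)\<^sup>2)"
    using E orthonormal_expansion_inner[of E w w]
    unfolding power2_norm_eq_inner by (simp add: orthonormal_basis_def power2_eq_square)
  have "(\<Prod>e\<in>E. normal_density 0 \<sigma> (w \<bullet> e))
      = (\<Prod>e\<in>E. 1 / sqrt (2 * pi * \<sigma>\<^sup>2)) * (\<Prod>e\<in>E. exp (- (w \<bullet> e)\<^sup>2 / (2 * \<sigma>\<^sup>2)))"
    unfolding normal_density_def prod.distrib by simp
  also have "(\<Prod>e\<in>E. exp (- (w \<bullet> e)\<^sup>2 / (2 * \<sigma>\<^sup>2))) = exp (- (norm w)\<^sup>2 / (2 * \<sigma>\<^sup>2))"
    by (simp add: exp_sum[symmetric] orthonormal_basis_finite[OF E] norm sum_negf sum_divide_distrib)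
  also have "(\<Prod>e\<in>E. 1 / sqrt (2 * pi * \<sigma>\<^sup>2)) = 1 / sqrt ((2 * pi * \<sigma>\<^sup>2) ^ CARD('n))"
    by (simp add: orthonormal_basis_card[OF E] power_divide real_sqrt_power)
  finally show ?thesis by (simp add: isotropic_normal_density_def)
qed

text \<open>
  Tilting by \<open>x\<^sup>2 / (4 \<sigma>\<^sup>2)\<close> halves the exponent, that is, doubles the variance; the normalizing
  constant changes by the factor \<open>sqrt 2\<close>.
\<close>

lemma normal_density_exp_square:
  assumes "\<sigma> > 0"
  shows "normal_density 0 \<sigma> x * exp (x\<^sup>2 / (4 * \<sigma>\<^sup>2)) = sqrt 2 * normal_density 0 (sqrt 2 * \<sigma>) x"
proof -
  have "- x\<^sup>2 / (2 * \<sigma>\<^sup>2) + x\<^sup>2 / (4 * \<sigma>\<^sup>2) = - x\<^sup>2 / (4 * \<sigma>\<^sup>2)"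
    using assms by (simp add: field_simps)
  then have "exp (- x\<^sup>2 / (2 * \<sigma>\<^sup>2)) * exp (x\<^sup>2 / (4 * \<sigma>\<^sup>2)) = exp (- x\<^sup>2 / (4 * \<sigma>\<^sup>2))"
    by (simp only: exp_add[symmetric])
  moreover have "sqrt (2 * pi * (sqrt 2 * \<sigma>)\<^sup>2) = sqrt 2 * sqrt (2 * pi * \<sigma>\<^sup>2)"
    by (simp add: real_sqrt_mult power_mult_distrib)
  ultimately show ?thesis
    by (simp add: normal_density_def power_mult_distrib)
qed

text \<open>
  Completing the square moves the mean and leaves the variance unchanged.
\<close>

lemma normal_density_exp_linear:
  assumes "\<sigma> > 0"
  shows "normal_density 0 \<sigma> x * exp (- (m * x) / (2 * \<sigma>\<^sup>2))
    = exp (m\<^sup>2 / (8 * \<sigma>\<^sup>2)) * normal_density (- m / 2) \<sigma> x"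
proof -
  have "- x\<^sup>2 / (2 * \<sigma>\<^sup>2) + - (m * x) / (2 * \<sigma>\<^sup>2) = m\<^sup>2 / (8 * \<sigma>\<^sup>2) + - (x - - m / 2)\<^sup>2 / (2 * \<sigma>\<^sup>2)"
    using assms by (simp add: field_simps power2_eq_square)
  then have "exp (- x\<^sup>2 / (2 * \<sigma>\<^sup>2)) * exp (- (m * x) / (2 * \<sigma>\<^sup>2))
      = exp (m\<^sup>2 / (8 * \<sigma>\<^sup>2)) * exp (- (x - - m / 2)\<^sup>2 / (2 * \<sigma>\<^sup>2))"
    by (simp only: exp_add[symmetric])
  then show ?thesis by (simp add: normal_density_def)
qed

text \<open>
  In an orthonormal basis that extends \<open>B\<close> the integrand is a product of functions of one coordinate
  each, because \<open>v\<close> has no component along \<open>B\<close>: the coordinates in \<open>B\<close> carry only the quadratic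
  term, the others only the linear one. Each coordinate in \<open>B\<close> contributes a factor \<open>sqrt 2\<close>.
\<close>

lemma gaussian_exponential_moment:
  fixes v :: "real^'n"
  assumes \<sigma>: "\<sigma> > 0" and B: "pairwise orthogonal B" "\<forall>b\<in>B. norm b = 1" and v: "\<forall>b\<in>B. b \<bullet> v = 0"
  shows "(\<integral>\<^sup>+w. ennreal (isotropic_normal_density \<sigma> w) *
      ennreal (exp (((\<Sum>b\<in>B. (w \<bullet> b)\<^sup>2) - 2 * (v \<bullet> w)) / (4 * \<sigma>\<^sup>2))) \<partial>lborel)
    = ennreal (sqrt 2 ^ card B * exp ((norm v)\<^sup>2 / (8 * \<sigma>\<^sup>2)))"
proof -
  obtain E where E: "B \<subseteq> E" "orthonormal_basis E"
    by (rule orthonormal_extends_to_basis[OF B(1) B(2)[rule_format]])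
  have fin: "finite E" using E(2) by (rule orthonormal_basis_finite)
  have vw: "v \<bullet> w = (\<Sum>e\<in>E - B. (v \<bullet> e) * (w \<bullet> e))" for w
  proof -
    have "v \<bullet> w = (\<Sum>e\<in>E. (v \<bullet> e) * (w \<bullet> e))"
      using E(2) by (intro orthonormal_expansion_inner) (auto simp: orthonormal_basis_def)
    also have "\<dots> = (\<Sum>e\<in>E - B. (v \<bullet> e) * (w \<bullet> e))"
    proof (rule sum.mono_neutral_right[OF fin])
      have "v \<bullet> e = 0" if "e \<in> B" for e using v that by (metis inner_commute)
      then show "\<forall>e\<in>E - (E - B). (v \<bullet> e) * (w \<bullet> e) = 0" by auto
    qed blast
    finally show ?thesis .
  qed
  define C where "C e = (if e \<in> B then sqrt 2 else exp ((v \<bullet> e)\<^sup>2 / (8 * \<sigma>\<^sup>2)))" for e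
  define q where "q e = (if e \<in> B then normal_density 0 (sqrt 2 * \<sigma>)
      else normal_density (- (v \<bullet> e) / 2) \<sigma>)" for e
  have C0: "0 \<le> C e" for e by (simp add: C_def)
  have q0: "0 \<le> q e x" for e x by (simp add: q_def normal_density_nonneg)
  have [measurable]: "q e \<in> borel_measurable borel" for e by (simp add: q_def)
  have q1: "(\<integral>\<^sup>+x. ennreal (q e x) \<partial>lborel) = 1" for e
    using \<sigma> by (simp add: q_def nn_integral_normal_density)
  have integrand: "ennreal (isotropic_normal_density \<sigma> w) *
      ennreal (exp (((\<Sum>b\<in>B. (w \<bullet> b)\<^sup>2) - 2 * (v \<bullet> w)) / (4 * \<sigma>\<^sup>2)))
    = (\<Prod>e\<in>E. ennreal (C e * q e (w \<bullet> e)))" for w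
  proof -
    define L where "L e = (if e \<in> B then (w \<bullet> e)\<^sup>2 / (4 * \<sigma>\<^sup>2)
        else - ((v \<bullet> e) * (w \<bullet> e)) / (2 * \<sigma>\<^sup>2))" for e
    have "((\<Sum>b\<in>B. (w \<bullet> b)\<^sup>2) - 2 * (v \<bullet> w)) / (4 * \<sigma>\<^sup>2)
        = (\<Sum>b\<in>B. (w \<bullet> b)\<^sup>2) / (4 * \<sigma>\<^sup>2) + - (v \<bullet> w) / (2 * \<sigma>\<^sup>2)"
      by (simp add: diff_divide_distrib)
    also have "\<dots> = (\<Sum>e\<in>B. (w \<bullet> e)\<^sup>2 / (4 * \<sigma>\<^sup>2))
        + (\<Sum>e\<in>E - B. - ((v \<bullet> e) * (w \<bullet> e)) / (2 * \<sigma>\<^sup>2))"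
      by (simp only: vw[of w] sum_divide_distrib sum_negf[symmetric])
    also have "\<dots> = (\<Sum>e\<in>B. L e) + (\<Sum>e\<in>E - B. L e)"
      by (intro arg_cong2[where f = "(+)"] sum.cong) (auto simp: L_def)
    also have "\<dots> = (\<Sum>e\<in>E. L e)"
      using sum.subset_diff[OF E(1) fin, of L] by simp
    finally have "exp (((\<Sum>b\<in>B. (w \<bullet> b)\<^sup>2) - 2 * (v \<bullet> w)) / (4 * \<sigma>\<^sup>2)) = (\<Prod>e\<in>E. exp (L e))"
      by (simp only: exp_sum[OF fin])
    then have "isotropic_normal_density \<sigma> w * exp (((\<Sum>b\<in>B. (w \<bullet> b)\<^sup>2) - 2 * (v \<bullet> w)) / (4 * \<sigma>\<^sup>2))
        = (\<Prod>e\<in>E. normal_density 0 \<sigma> (w \<bullet> e) * exp (L e))"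
      by (simp add: isotropic_normal_density_orthonormal[OF E(2)] prod.distrib)
    also have "\<dots> = (\<Prod>e\<in>E. C e * q e (w \<bullet> e))"
      using normal_density_exp_square[OF \<sigma>] normal_density_exp_linear[OF \<sigma>]
      by (intro prod.cong) (auto simp: L_def C_def q_def)
    finally show ?thesis
      by (simp add: ennreal_mult''[symmetric] prod_ennreal C0 q0)
  qed
  have "(\<integral>\<^sup>+w. (\<Prod>e\<in>E. ennreal (C e * q e (w \<bullet> e))) \<partial>lborel)
      = (\<Prod>e\<in>E. \<integral>\<^sup>+x. ennreal (C e * q e x) \<partial>lborel)"
    by (rule nn_integral_orthonormal_basis_prod[OF E(2), of "\<lambda>e x. ennreal (C e * q e x)"]) measurable
  also have "\<dots> = (\<Prod>e\<in>E. ennreal (C e))"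
    by (simp add: ennreal_mult C0 q0 nn_integral_cmult q1)
  also have "\<dots> = ennreal (\<Prod>e\<in>E. C e)" by (simp add: prod_ennreal C0)
  also have "(\<Prod>e\<in>E. C e) = (\<Prod>e\<in>E - B. C e) * (\<Prod>e\<in>B. C e)"
    by (rule prod.subset_diff[OF E(1) fin])
  also have "(\<Prod>e\<in>B. C e) = sqrt 2 ^ card B" by (simp add: C_def)
  also have "(\<Prod>e\<in>E - B. C e) = exp ((norm v)\<^sup>2 / (8 * \<sigma>\<^sup>2))"
  proof -
    have "(\<Sum>e\<in>E - B. (v \<bullet> e)\<^sup>2 / (8 * \<sigma>\<^sup>2)) = (norm v)\<^sup>2 / (8 * \<sigma>\<^sup>2)"
      unfolding power2_norm_eq_inner vw[of v] by (simp add: power2_eq_square sum_divide_distrib)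
    then show ?thesis using fin by (simp add: C_def exp_sum[symmetric])
  qed
  finally show ?thesis unfolding integrand by (simp add: mult.commute)
qed

text \<open>
  Chernoff's bound with exponent \<open>1 / (4 \<sigma>\<^sup>2)\<close>. The bound \<open>1 / (2 \<sigma>\<^sup>2)\<close> is where the moment becomes
  infinite; half of it minimizes the exponent coming from \<open>v\<close>.
\<close>

lemma gaussian_quadratic_tail:
  fixes W :: "'a \<Rightarrow> real^'n"
  assumes prob: "prob_space \<Omega>" and \<sigma>: "\<sigma> > 0"
    and W: "distributed \<Omega> lborel W (\<lambda>w. ennreal (isotropic_normal_density \<sigma> w))"
    and B: "pairwise orthogonal B" "\<forall>b\<in>B. norm b = 1" and v: "\<forall>b\<in>B. b \<bullet> v = 0"
  defines "Q \<equiv> \<lambda>w. (norm v)\<^sup>2 + 2 * (v \<bullet> w) - (\<Sum>b\<in>B. (w \<bullet> b)\<^sup>2)"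
  shows "{\<omega> \<in> space \<Omega>. Q (W \<omega>) \<le> 0} \<in> sets \<Omega>"
    and "\<P>(\<omega> in \<Omega>. Q (W \<omega>) \<le> 0) \<le> sqrt 2 ^ card B * exp (- (norm v)\<^sup>2 / (8 * \<sigma>\<^sup>2))"
proof -
  interpret prob_space \<Omega> by fact
  have [measurable]: "W \<in> borel_measurable \<Omega>"
    using distributed_measurable[OF W] by simp
  have [measurable]: "Q \<in> borel_measurable borel" unfolding Q_def by measurable
  show "{\<omega> \<in> space \<Omega>. Q (W \<omega>) \<le> 0} \<in> sets \<Omega>" by measurable
  let ?s = "1 / (4 * \<sigma>\<^sup>2)"
  let ?L = "\<lambda>w. ((\<Sum>b\<in>B. (w \<bullet> b)\<^sup>2) - 2 * (v \<bullet> w)) / (4 * \<sigma>\<^sup>2)"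
  have "emeasure \<Omega> {\<omega> \<in> space \<Omega>. Q (W \<omega>) \<le> 0}
      \<le> ennreal (exp (?s * 0)) * (\<integral>\<^sup>+\<omega>. ennreal (exp (- ?s * Q (W \<omega>))) * indicator (space \<Omega>) \<omega> \<partial>\<Omega>)"
    using \<sigma> by (intro Chernoff_ineq_nn_integral_le) simp_all
  also have "\<dots> = (\<integral>\<^sup>+\<omega>. ennreal (exp (- (norm v)\<^sup>2 / (4 * \<sigma>\<^sup>2))) * ennreal (exp (?L (W \<omega>))) \<partial>\<Omega>)"
  proof -
    have "- ?s * Q w = - (norm v)\<^sup>2 / (4 * \<sigma>\<^sup>2) + ?L w" for w
      unfolding Q_def by (simp add: diff_divide_distrib add_divide_distrib)
    then have "ennreal (exp (- ?s * Q w)) = ennreal (exp (- (norm v)\<^sup>2 / (4 * \<sigma>\<^sup>2))) * ennreal (exp (?L w))" for w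
      by (simp only: exp_add ennreal_mult[OF exp_ge_zero exp_ge_zero])
    then show ?thesis by (simp cong: nn_integral_cong)
  qed
  also have "\<dots> = ennreal (exp (- (norm v)\<^sup>2 / (4 * \<sigma>\<^sup>2))) * (\<integral>\<^sup>+\<omega>. ennreal (exp (?L (W \<omega>))) \<partial>\<Omega>)"
    by (rule nn_integral_cmult) measurable
  also have "(\<integral>\<^sup>+\<omega>. ennreal (exp (?L (W \<omega>))) \<partial>\<Omega>)
      = (\<integral>\<^sup>+w. ennreal (isotropic_normal_density \<sigma> w) * ennreal (exp (?L w)) \<partial>lborel)"
    by (rule distributed_nn_integral[OF W, symmetric]) measurable
  also have "\<dots> = ennreal (sqrt 2 ^ card B * exp ((norm v)\<^sup>2 / (8 * \<sigma>\<^sup>2)))"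
    by (rule gaussian_exponential_moment[OF \<sigma> B v])
  also have "ennreal (exp (- (norm v)\<^sup>2 / (4 * \<sigma>\<^sup>2))) * \<dots>
      = ennreal (exp (- (norm v)\<^sup>2 / (4 * \<sigma>\<^sup>2)) * (sqrt 2 ^ card B * exp ((norm v)\<^sup>2 / (8 * \<sigma>\<^sup>2))))"
    by (rule ennreal_mult[symmetric]) simp_all
  also have "exp (- (norm v)\<^sup>2 / (4 * \<sigma>\<^sup>2)) * (sqrt 2 ^ card B * exp ((norm v)\<^sup>2 / (8 * \<sigma>\<^sup>2)))
      = sqrt 2 ^ card B * exp (- (norm v)\<^sup>2 / (8 * \<sigma>\<^sup>2))"
  proof -
    have "- (norm v)\<^sup>2 / (4 * \<sigma>\<^sup>2) + (norm v)\<^sup>2 / (8 * \<sigma>\<^sup>2) = - (norm v)\<^sup>2 / (8 * \<sigma>\<^sup>2)"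
      using \<sigma> by (simp add: field_simps)
    then show ?thesis by (simp only: mult.left_commute exp_add[symmetric])
  qed
  finally show "\<P>(\<omega> in \<Omega>. Q (W \<omega>) \<le> 0) \<le> sqrt 2 ^ card B * exp (- (norm v)\<^sup>2 / (8 * \<sigma>\<^sup>2))"
    by (simp add: emeasure_eq_measure)
qed

section \<open>The error probability\<close>

text \<open>
  Each of the \<open>m\<close> factors \<open>sqrt 2\<close> is at most \<open>exp 1\<close>, and \<open>m \<le> a / c\<close>. So the product is at most
  \<open>exp (a / c - a / 8)\<close>, and \<open>2 / c \<le> 1 / 8\<close>.
\<close>

lemma exponent_arithmetic:
  fixes a c :: real
  assumes "c \<ge> 16" "c * real k \<le> a" "m \<le> k"
  shows "sqrt 2 ^ m * exp (- a / 8) \<le> exp (- (a / c))"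
proof -
  have "sqrt 2 \<le> exp (1::real)"
    using exp_ge_add_one_self[of 1] sqrt_le_D[of 2 2] real_sqrt_le_iff[of 2 4] by simp
  then have "sqrt 2 ^ m \<le> exp 1 ^ m" by (intro power_mono) auto
  also have "\<dots> = exp (real m)" by (simp add: exp_of_nat_mult[symmetric])
  also have "\<dots> \<le> exp (a / c)"
    using assms by (simp add: le_divide_eq mult.commute order_trans[OF mult_left_mono[of "real m" "real k" c]])
  finally have "sqrt 2 ^ m * exp (- a / 8) \<le> exp (a / c) * exp (- a / 8)"
    by (intro mult_right_mono) auto
  also have "\<dots> = exp (a / c - a / 8)" by (simp add: exp_add[symmetric])
  also have "\<dots> \<le> exp (- (a / c))"
  proof -
    have "0 \<le> c * real k" using assms(1) by simp
    then have "0 \<le> a" using assms(2) by linarith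
    then have "a / c \<le> a / 16" using assms(1) by (intro divide_left_mono) auto
    then have "a / c - a / 8 \<le> - (a / c)" by linarith
    then show ?thesis by (simp only: exp_le_cancel_iff)
  qed
  finally show ?thesis .
qed

theorem lemma3p1:
  fixes X :: "real^'d^'n" and \<beta> :: "real^'d" and \<sigma> c :: real
    and \<Omega> :: "'a measure" and W Y :: "'a \<Rightarrow> real^'n" and S :: "'d set"
  assumes "prob_space \<Omega>"
    and "\<sigma> > 0"
    and "distributed \<Omega> lborel W (\<lambda>w. ennreal (isotropic_normal_density \<sigma> w))"
    and "\<And>\<omega>. \<omega> \<in> space \<Omega> \<Longrightarrow> Y \<omega> = X *v \<beta> + W \<omega>"
    and "S = vec_support \<beta>"
    and "card S \<le> min CARD('n) CARD('d)"
    and "c = 4 * (3 + sqrt 5)"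
    and "rank (subcols X S) = card S"
  shows "\<forall>C :: 'd set. C \<noteq> S \<and> card C = card S \<and>
      (norm (psd_sqrt (G_matrix X S C) *v subvec \<beta> (S - C)))\<^sup>2
        \<ge> c * \<sigma>\<^sup>2 * real (card (S - C)) / real CARD('n) \<longrightarrow>
      \<P>(\<omega> in \<Omega>. Delta_hat X C S (Y \<omega>) \<le> 0)
        \<le> 3 * exp (- ((norm (psd_sqrt (G_matrix X S C) *v subvec \<beta> (S - C)))\<^sup>2
                        / (c * \<sigma>\<^sup>2) * real CARD('n)))"
proof (intro allI impI, elim conjE)
  fix C :: "'d set"
  define g where "g = (norm (psd_sqrt (G_matrix X S C) *v subvec \<beta> (S - C)))\<^sup>2"
  assume "card C = card S"
    and signal: "c * \<sigma>\<^sup>2 * real (card (S - C)) / real CARD('n)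
      \<le> (norm (psd_sqrt (G_matrix X S C) *v subvec \<beta> (S - C)))\<^sup>2"
  interpret prob_space \<Omega> by fact
  define v where "v = proj_perp X C *v (X *v \<beta>)"
  define a where "a = (norm v)\<^sup>2 / \<sigma>\<^sup>2"
  have g: "real CARD('n) * g = (norm v)\<^sup>2"
    unfolding g_def v_def by (rule signal_strength[OF assms(5)])
  have a: "g / (c * \<sigma>\<^sup>2) * real CARD('n) = a / c"
    unfolding a_def g[symmetric] by (simp add: mult_ac)
  have "c * \<sigma>\<^sup>2 * real (card (S - C)) \<le> (norm v)\<^sup>2"
    using signal unfolding g_def[symmetric] g[symmetric] by (simp add: pos_divide_le_eq mult.commute)
  then have ck: "c * real (card (S - C)) \<le> a"
    using assms(2) by (simp add: a_def pos_le_divide_eq mult_ac)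
  have "1 \<le> sqrt 5" by simp
  then have c: "c \<ge> 16" using assms(7) by simp
  have "card (C - S) = card (S - C)"
    using \<open>card C = card S\<close> by (intro card_le_sym_Diff antisym card_le_sym_Diff) auto
  obtain B where B: "pairwise orthogonal B" "\<forall>b\<in>B. norm b = 1" "\<forall>b\<in>B. b \<bullet> v = 0"
      "card B \<le> card (C - S)"
      "\<forall>w. (norm v)\<^sup>2 + 2 * (v \<bullet> w) - (\<Sum>b\<in>B. (w \<bullet> b)\<^sup>2) \<le> Delta_hat X C S (X *v \<beta> + w)"
    by (rule Delta_hat_lower_bound[OF assms(5) v_def])
  define Q where "Q w = (norm v)\<^sup>2 + 2 * (v \<bullet> w) - (\<Sum>b\<in>B. (w \<bullet> b)\<^sup>2)" for w
  note tail = gaussian_quadratic_tail[OF assms(1-3) B(1-3), folded Q_def]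
  have "Q (W \<omega>) \<le> 0" if "\<omega> \<in> space \<Omega>" "Delta_hat X C S (Y \<omega>) \<le> 0" for \<omega>
    using B(5)[rule_format, of "W \<omega>"] that assms(4) by (simp add: Q_def)
  then have "\<P>(\<omega> in \<Omega>. Delta_hat X C S (Y \<omega>) \<le> 0) \<le> \<P>(\<omega> in \<Omega>. Q (W \<omega>) \<le> 0)"
    by (intro finite_measure_mono tail(1)) blast
  also have "\<dots> \<le> sqrt 2 ^ card B * exp (- (norm v)\<^sup>2 / (8 * \<sigma>\<^sup>2))" by (rule tail(2))
  also have "\<dots> = sqrt 2 ^ card B * exp (- a / 8)" by (simp add: a_def mult.commute)
  also have "\<dots> \<le> exp (- (a / c))"
    using B(4) \<open>card (C - S) = card (S - C)\<close> by (intro exponent_arithmetic[OF c ck]) simp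
  also have "\<dots> \<le> 3 * exp (- (a / c))" by simp
  finally show "\<P>(\<omega> in \<Omega>. Delta_hat X C S (Y \<omega>) \<le> 0)
        \<le> 3 * exp (- ((norm (psd_sqrt (G_matrix X S C) *v subvec \<beta> (S - C)))\<^sup>2
                        / (c * \<sigma>\<^sup>2) * real CARD('n)))"
    unfolding g_def[symmetric] a .
qed

end
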